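(* For every integer $n\ge 6$, the complement $\overline{W_n}$ of the wheel graph $W_n$ contains $K_{\lfloor 3(n-1)/4\rfloor}$ as a minor.
   Context: For $n\ge 4$, the wheel graph $W_n$ on $n$ vertices is the join $K_1+C_{n-1}$: a cycle on $n-1$ vertices together with one additional vertex adjacent to all vertices of the cycle. The complement $\overline{G}$ has the same vertex set as $G$, with two distinct vertices adjacent iff they are not adjacent in $G$. Minors are obtained by vertex deletions, edge deletions and edge contractions. *)

theory Defs
  imports "Graph_Theory.Graph_Theory"
begin

text \<open>
  A finite simple graph is a value of type \<open>'a pair_pre_digraph\<close> satisfying
  \<open>pair_graph\<close>: an undirected edge \<open>uv\<close> is the pair of opposite arcs
  \<open>(u, v)\<close> and \<open>(v, u)\<close>, and there are no loops.
\<close>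

definition single_vertex_graph :: "unit pair_pre_digraph" where
  "single_vertex_graph = \<lparr> pverts = {()}, parcs = {} \<rparr>"

text \<open>The definition describes the cycle only for \<open>m \<ge> 3\<close>; for \<open>m = 1\<close> it has a loop.\<close>

definition cycle_graph :: "nat \<Rightarrow> nat pair_pre_digraph" where
  "cycle_graph m = \<lparr> pverts = {..<m},
     parcs = {(u, v). u < m \<and> v < m \<and> (v = (u + 1) mod m \<or> u = (v + 1) mod m)} \<rparr>"

definition graph_join ::
    "'a pair_pre_digraph \<Rightarrow> 'b pair_pre_digraph \<Rightarrow> ('a + 'b) pair_pre_digraph" where
  "graph_join G H = \<lparr> pverts = pverts G <+> pverts H,
     parcs = map_prod Inl Inl ` parcs G \<union> map_prod Inr Inr ` parcs H
       \<union> (Inl ` pverts G) \<times> (Inr ` pverts H) \<union> (Inr ` pverts H) \<times> (Inl ` pverts G) \<rparr>"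

definition wheel_graph :: "nat \<Rightarrow> (unit + nat) pair_pre_digraph" where
  "wheel_graph n = graph_join single_vertex_graph (cycle_graph (n - 1))"

definition graph_complement :: "'a pair_pre_digraph \<Rightarrow> 'a pair_pre_digraph" where
  "graph_complement G = \<lparr> pverts = pverts G,
     parcs = {(u, v). u \<in> pverts G \<and> v \<in> pverts G \<and> u \<noteq> v \<and> (u, v) \<notin> parcs G} \<rparr>"

definition delete_vertex :: "'a \<Rightarrow> 'a pair_pre_digraph \<Rightarrow> 'a pair_pre_digraph" where
  "delete_vertex w G = \<lparr> pverts = pverts G - {w},
     parcs = {(u, v) \<in> parcs G. u \<noteq> w \<and> v \<noteq> w} \<rparr>"

definition delete_edge :: "'a \<Rightarrow> 'a \<Rightarrow> 'a pair_pre_digraph \<Rightarrow> 'a pair_pre_digraph" where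
  "delete_edge u v G = \<lparr> pverts = pverts G, parcs = parcs G - {(u, v), (v, u)} \<rparr>"

text \<open>
  Contracting the edge \<open>uv\<close> identifies \<open>v\<close> with \<open>u\<close>, the merged vertex keeping
  the name \<open>u\<close>. Loops that arise are dropped, and parallel edges coincide.
\<close>

definition contract_edge :: "'a \<Rightarrow> 'a \<Rightarrow> 'a pair_pre_digraph \<Rightarrow> 'a pair_pre_digraph" where
  "contract_edge u v G = \<lparr> pverts = pverts G - {v},
     parcs = {(x, y) \<in> map_prod (id(v := u)) (id(v := u)) ` parcs G. x \<noteq> y} \<rparr>"

inductive minor_step :: "'a pair_pre_digraph \<Rightarrow> 'a pair_pre_digraph \<Rightarrow> bool" for G where
  vertex_deletion: "w \<in> pverts G \<Longrightarrow> minor_step G (delete_vertex w G)"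
| edge_deletion: "(u, v) \<in> parcs G \<Longrightarrow> minor_step G (delete_edge u v G)"
| edge_contraction: "(u, v) \<in> parcs G \<Longrightarrow> minor_step G (contract_edge u v G)"

definition is_minor :: "'a pair_pre_digraph \<Rightarrow> 'a pair_pre_digraph \<Rightarrow> bool" where
  "is_minor H G \<longleftrightarrow> minor_step\<^sup>*\<^sup>* G H"

text \<open>\<open>complete_digraph t\<close> is a predicate invariant under isomorphism, so minors need not
  be closed under isomorphism.\<close>

definition contains_complete_minor :: "'a pair_pre_digraph \<Rightarrow> nat \<Rightarrow> bool" where
  "contains_complete_minor G t \<longleftrightarrow> (\<exists>H. is_minor H G \<and> complete_digraph t (with_proj H))"

lemma pair_graphI:
  assumes "finite (pverts G)" "parcs G \<subseteq> pverts G \<times> pverts G"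
    and "\<And>u v. (u, v) \<in> parcs G \<Longrightarrow> (v, u) \<in> parcs G"
    and "\<And>u. (u, u) \<notin> parcs G"
  shows "pair_graph G"
proof -
  have "finite (parcs G)"
    using assms(1,2) by (meson finite_SigmaI finite_subset)
  then show ?thesis
    using assms by unfold_locales (auto simp: symmetric_def intro!: symI)
qed

lemma pair_graphD:
  assumes "pair_graph G"
  shows "finite (pverts G)" "parcs G \<subseteq> pverts G \<times> pverts G"
    and "\<And>u v. (u, v) \<in> parcs G \<Longrightarrow> (v, u) \<in> parcs G"
    and "\<And>u. (u, u) \<notin> parcs G"
proof -
  interpret pair_graph G by fact
  show "finite (pverts G)" by (rule pair_finite_verts)
  show "parcs G \<subseteq> pverts G \<times> pverts G" by (auto dest: in_arcsD1 in_arcsD2)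
  show "(v, u) \<in> parcs G" if "(u, v) \<in> parcs G" for u v using that by (rule arcs_symmetric)
  show "(u, u) \<notin> parcs G" for u using no_loops'[of u u] by auto
qed

lemma pair_graph_cycle_graph:
  assumes "m \<ge> 3" shows "pair_graph (cycle_graph m)"
proof (rule pair_graphI)
  fix u show "(u, u) \<notin> parcs (cycle_graph m)"
    using assms by (cases "u + 1 = m") (auto simp: cycle_graph_def)
qed (auto simp: cycle_graph_def)

lemma pair_graph_graph_join:
  assumes "pair_graph G" "pair_graph H" shows "pair_graph (graph_join G H)"
  using pair_graphD[OF assms(1)] pair_graphD[OF assms(2)]
  by (intro pair_graphI) (fastforce simp: graph_join_def)+

lemma pair_graph_wheel_graph:
  assumes "n \<ge> 4" shows "pair_graph (wheel_graph n)"
proof -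
  have "pair_graph single_vertex_graph"
    by (rule pair_graphI) (auto simp: single_vertex_graph_def)
  then show ?thesis
    unfolding wheel_graph_def using assms
    by (intro pair_graph_graph_join pair_graph_cycle_graph) auto
qed

lemma card_pverts_wheel_graph:
  assumes "n \<ge> 1" shows "card (pverts (wheel_graph n)) = n"
  using assms
  by (simp add: wheel_graph_def graph_join_def single_vertex_graph_def cycle_graph_def card_Plus)

lemma pair_graph_graph_complement:
  assumes "pair_graph G" shows "pair_graph (graph_complement G)"
  using pair_graphD[OF assms] by (intro pair_graphI) (auto simp: graph_complement_def)

lemma pair_graph_minor_step:
  assumes "minor_step G H" "pair_graph G" shows "pair_graph H"
  using assms(1)
proof cases
  case (edge_contraction u v)
  show ?thesis
  proof (rule pair_graphI)
    fix x y assume "(x, y) \<in> parcs H"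
    then show "(y, x) \<in> parcs H"
      using pair_graphD(3)[OF assms(2)]
      by (force simp: edge_contraction(1) contract_edge_def)
  next
    show "parcs H \<subseteq> pverts H \<times> pverts H"
      using pair_graphD(2,4)[OF assms(2)] edge_contraction(2)
      by (auto simp: edge_contraction(1) contract_edge_def split: if_splits)
  qed (use pair_graphD[OF assms(2)] in \<open>auto simp: edge_contraction(1) contract_edge_def\<close>)
qed (use pair_graphD[OF assms(2)] in
    \<open>auto simp: delete_vertex_def delete_edge_def intro!: pair_graphI\<close>)

lemma pair_graph_is_minor:
  assumes "is_minor H G" "pair_graph G" shows "pair_graph H"
  using assms(1)[unfolded is_minor_def] assms(2)
  by (induction rule: rtranclp_induct) (auto intro: pair_graph_minor_step)

end

theory Submission
  imports Defs
begin

text \<open>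
  The centre of the wheel is isolated in the complement and is deleted, which leaves the complement
  of the cycle on \<open>{..<m}\<close>, \<open>m = n - 1\<close>. The branch sets are the singletons \<open>{x}\<close> for the
  \<open>m div 2\<close> even \<open>x < m - 1\<close>, which are independent in the cycle, and \<open>h = (m + 1) div 4\<close> further
  sets: \<open>{a, a + 2 * h}\<close> for odd \<open>a < 2 * h - 1\<close>, and one set that consists of \<open>2 * h - 1\<close> and all
  vertices left over. None of these further sets lies in the cycle neighbourhood of an even
  \<open>x < m - 1\<close>, so in the complement each is joined to every singleton. Each is a star in the
  complement, so it can be contracted onto its hub \<open>a\<close> (or \<open>2 * h - 1\<close>) one leaf at a time.
\<close>

section \<open>Contracting disjoint stars\<close>

text \<open>The simple quotient of \<open>G\<close> along \<open>r\<close>: the fibres of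
  \<open>r\<close> are the branch sets, named by their images.\<close>

definition map_graph :: "('a \<Rightarrow> 'a) \<Rightarrow> 'a pair_pre_digraph \<Rightarrow> 'a pair_pre_digraph" where
  "map_graph r G = \<lparr> pverts = r ` pverts G,
     parcs = {(x, y) \<in> map_prod r r ` parcs G. x \<noteq> y} \<rparr>"

text \<open>The moved vertices are contracted one at a time onto their images. Images are fixed by
  \<open>r\<close>, so a hub is never contracted away and keeps its arc to every leaf that
  remains.\<close>

lemma is_minor_map_graph:
  assumes G: "pair_graph G"
    and star: "\<And>v. v \<in> pverts G \<Longrightarrow> r v \<noteq> v \<Longrightarrow> (r v, v) \<in> parcs G"
    and idem: "\<And>v. v \<in> pverts G \<Longrightarrow> r (r v) = r v"
  shows "is_minor (map_graph r G) G"
proof -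
  note wf = pair_graphD[OF G]
  \<comment> \<open>\<open>f S\<close> records the stage at which exactly the vertices in
    \<open>S\<close> have been contracted.\<close>
  define f where "f S x = (if x \<in> S then r x else x)" for S x
  have "is_minor (map_graph (f S) G) G"
    if "finite S" "S \<subseteq> {v \<in> pverts G. r v \<noteq> v}" for S
    using that
  proof (induction S)
    case empty
    have "f {} = id" by (auto simp: f_def)
    then have "map_graph (f {}) G = G"
      using wf(4) by (auto simp: map_graph_def prod.map_id0 intro!: pair_pre_digraph.equality)
    then show ?case by (simp add: is_minor_def)
  next
    case (insert v S)
    let ?H = "map_graph (f S) G" and ?s = "id(v := r v)"
    have v: "v \<in> pverts G" "r v \<noteq> v" "v \<notin> S" and rv: "r v \<notin> S" "r (r v) = r v"
      using insert idem by auto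
    \<comment> \<open>For \<open>x\<close> in \<open>S\<close>, \<open>r x\<close> is fixed by
      \<open>r\<close> while \<open>v\<close> is not, so \<open>r x\<close> differs from
      \<open>v\<close> and the update does not touch it.\<close>
    have f_insert: "f (insert v S) x = ?s (f S x)" if "x \<in> pverts G" for x
      using that v idem[of x] by (auto simp: f_def)
    \<comment> \<open>Neither \<open>v\<close> nor \<open>r v\<close> lies in \<open>S\<close>, so
      \<open>f S\<close> fixes both and the star arc is still present.\<close>
    have "(f S (r v), f S v) \<in> map_prod (f S) (f S) ` parcs G"
      using star v by force
    then have arc: "(r v, v) \<in> parcs ?H"
      using v rv by (auto simp: map_graph_def f_def)
    have notv: "f S x \<noteq> v" if "x \<in> pverts G" "x \<noteq> v" for x
      using that v idem[of x] by (auto simp: f_def)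
    have verts: "?s ` f S ` pverts G = f S ` pverts G - {v}"
    proof
      have "r v \<in> f S ` pverts G"
        using star[OF v(1,2)] wf(2) rv by (force simp: f_def image_iff)
      then show "?s ` f S ` pverts G \<subseteq> f S ` pverts G - {v}"
        using v by auto
      show "f S ` pverts G - {v} \<subseteq> ?s ` f S ` pverts G"
        by (force simp: image_iff)
    qed
    have "map_prod (f (insert v S)) (f (insert v S)) ` parcs G
        = map_prod ?s ?s ` map_prod (f S) (f S) ` parcs G"
      unfolding image_image using wf(2) by (intro image_cong) (auto simp: f_insert)
    moreover have "f (insert v S) ` pverts G = ?s ` f S ` pverts G"
      unfolding image_image by (intro image_cong) (auto simp: f_insert)
    \<comment> \<open>A loop is mapped to a loop, so dropping loops before the contraction or only
      after it gives the same arcs.\<close>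
    moreover have "{(x, y) \<in> map_prod s s ` {(x, y) \<in> A. x \<noteq> y}. x \<noteq> y}
        = {(x, y) \<in> map_prod s s ` A. x \<noteq> y}" for s :: "'a \<Rightarrow> 'a" and A
      by force
    ultimately have "map_graph (f (insert v S)) G = contract_edge (r v) v ?H"
      using verts by (simp add: map_graph_def contract_edge_def)
    then have "minor_step ?H (map_graph (f (insert v S)) G)"
      using edge_contraction[OF arc] by simp
    then show ?case
      using insert by (auto simp: is_minor_def)
  qed
  from this[of "{v \<in> pverts G. r v \<noteq> v}"]
  have "is_minor (map_graph (f {v \<in> pverts G. r v \<noteq> v}) G) G"
    using wf(1) by simp
  moreover have "map_graph (f {v \<in> pverts G. r v \<noteq> v}) G = map_graph r G"
  proof -
    have eq: "f {v \<in> pverts G. r v \<noteq> v} x = r x" if "x \<in> pverts G" for x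
      using that by (auto simp: f_def)
    have "map_prod (f {v \<in> pverts G. r v \<noteq> v}) (f {v \<in> pverts G. r v \<noteq> v}) ` parcs G
        = map_prod r r ` parcs G"
      using wf(2) by (intro image_cong) (auto simp: eq)
    then show ?thesis
      by (simp add: map_graph_def eq)
  qed
  ultimately show ?thesis by simp
qed

text \<open>Reduces a complete minor to a retraction \<open>r\<close> with star-shaped fibres: once
  these are contracted, an arc between any two fibres makes the quotient complete.\<close>

lemma contains_complete_minor_stars:
  assumes G: "pair_graph G"
    and star: "\<And>v. v \<in> pverts G \<Longrightarrow> r v \<noteq> v \<Longrightarrow> (r v, v) \<in> parcs G"
    and idem: "\<And>v. v \<in> pverts G \<Longrightarrow> r (r v) = r v"
    and joined: "\<And>x y. x \<in> r ` pverts G \<Longrightarrow> y \<in> r ` pverts G \<Longrightarrow> x \<noteq> y \<Longrightarrow>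
      \<exists>(u, v) \<in> parcs G. r u = x \<and> r v = y"
  shows "contains_complete_minor G (card (r ` pverts G))"
proof -
  let ?H = "map_graph r G"
  have minor: "is_minor ?H G"
    by (rule is_minor_map_graph[OF G star idem])
  then interpret H: pair_graph ?H
    by (rule pair_graph_is_minor) (rule G)
  have verts: "pverts ?H = r ` pverts G"
    by (simp add: map_graph_def)
  have "parcs ?H = {(x, y). (x, y) \<in> pverts ?H \<times> pverts ?H \<and> x \<noteq> y}"
  proof (intro equalityI subrelI)
    fix x y assume "(x, y) \<in> parcs ?H"
    then obtain u v where "(u, v) \<in> parcs G" "x = r u" "y = r v" "x \<noteq> y"
      by (auto simp: map_graph_def)
    then show "(x, y) \<in> {(x, y). (x, y) \<in> pverts ?H \<times> pverts ?H \<and> x \<noteq> y}"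
      using pair_graphD(2)[OF G] unfolding verts by blast
  next
    fix x y assume "(x, y) \<in> {(x, y). (x, y) \<in> pverts ?H \<times> pverts ?H \<and> x \<noteq> y}"
    then have "x \<in> r ` pverts G" "y \<in> r ` pverts G" "x \<noteq> y"
      unfolding verts by blast+
    moreover from joined[OF this] obtain u v where "(u, v) \<in> parcs G" "r u = x" "r v = y"
      by blast
    ultimately show "(x, y) \<in> parcs ?H"
      by (force simp: map_graph_def)
  qed
  then have "complete_digraph (card (r ` pverts G)) (with_proj ?H)"
    unfolding complete_digraph_def
    using H.graph_axioms by (simp add: verts arcs_ends_def arc_to_ends_def)
  with minor show ?thesis
    by (auto simp: contains_complete_minor_def)
qed

lemma contains_complete_minor_delete_vertex:
  assumes "w \<in> pverts G" "contains_complete_minor (delete_vertex w G) t"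
  shows "contains_complete_minor G t"
  using assms vertex_deletion[OF assms(1)]
  unfolding contains_complete_minor_def is_minor_def
  by (meson converse_rtranclp_into_rtranclp)

section \<open>The branch sets on the cycle\<close>

text \<open>Ordering the endpoints replaces \<open>mod\<close> by linear conditions.\<close>

lemma cycle_graph_arc_iff:
  assumes "u < v" "v < m"
  shows "(u, v) \<in> parcs (cycle_graph m) \<longleftrightarrow> v = u + 1 \<or> (u = 0 \<and> v = m - 1)"
  using assms by (cases "v + 1 = m") (auto simp: cycle_graph_def)

text \<open>The retraction whose fibres are the branch sets. An even \<open>m - 1\<close> is a cycle
  neighbour of the even vertex 0, so it cannot be a singleton and joins the last star. The
  \<open>min\<close> sends every odd vertex from \<open>4 * h - 1\<close> on to that star as
  well.\<close>

definition hub :: "nat \<Rightarrow> nat \<Rightarrow> nat" where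
  "hub m x = (let h = (m + 1) div 4 in
     if even x then if x = m - 1 then 2 * h - 1 else x
     else if x < 2 * h then x else min (x - 2 * h) (2 * h - 1))"

lemma hub_eq:
  assumes "h = (m + 1) div 4"
  shows "hub m x = (if even x then if x = m - 1 then 2 * h - 1 else x
     else if x < 2 * h then x else min (x - 2 * h) (2 * h - 1))"
  unfolding hub_def Let_def assms ..

lemma hub_cases:
  assumes "5 \<le> m" "x < m"
  shows "even (hub m x) \<and> hub m x < m - 1 \<or> odd (hub m x) \<and> hub m x < 2 * ((m + 1) div 4)"
proof -
  define h where "h = (m + 1) div 4"
  have "1 \<le> h" using assms by (simp add: h_def)
  then show ?thesis
    unfolding hub_eq[OF h_def] h_def[symmetric] using assms by (auto simp: min_def)
qed

lemma hub_less:
  assumes "5 \<le> m" "x < m"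
  shows "hub m x < m"
  using hub_cases[OF assms] by auto

lemma hub_even: "even x \<Longrightarrow> x < m - 1 \<Longrightarrow> hub m x = x"
  by (simp add: hub_def)

lemma hub_odd: "odd x \<Longrightarrow> x < 2 * ((m + 1) div 4) \<Longrightarrow> hub m x = x"
  by (simp add: hub_def)

lemma hub_idem: "5 \<le> m \<Longrightarrow> x < m \<Longrightarrow> hub m (hub m x) = hub m x"
  using hub_cases hub_even hub_odd by metis

text \<open>The image splits by parity into \<open>m div 2\<close> singletons and
  \<open>(m + 1) div 4\<close> hubs; the residues of \<open>m\<close> modulo 4 show that the sum is
  the required floor.\<close>

lemma card_hub:
  assumes "5 \<le> m"
  shows "card (hub m ` {..<m}) = 3 * m div 4"
proof -
  let ?h = "(m + 1) div 4"
  have "hub m ` {..<m} = (\<lambda>i. 2 * i) ` {..<m div 2} \<union> (\<lambda>i. 2 * i + 1) ` {..<?h}"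
  proof (intro equalityI subsetI)
    fix y assume "y \<in> hub m ` {..<m}"
    then have "even y \<and> y < m - 1 \<or> odd y \<and> y < 2 * ?h"
      using hub_cases[OF assms] by blast
    then show "y \<in> (\<lambda>i. 2 * i) ` {..<m div 2} \<union> (\<lambda>i. 2 * i + 1) ` {..<?h}"
      by (auto elim!: evenE oddE)
  next
    fix y assume "y \<in> (\<lambda>i. 2 * i) ` {..<m div 2} \<union> (\<lambda>i. 2 * i + 1) ` {..<?h}"
    then have "hub m y = y" "y < m"
      using hub_even[of y m] hub_odd[of y m] assms by auto
    then show "y \<in> hub m ` {..<m}"
      by (metis image_eqI lessThan_iff)
  qed
  moreover have "card ((\<lambda>i. 2 * i) ` {..<m div 2} \<union> (\<lambda>i. 2 * i + 1) ` {..<?h}) = m div 2 + ?h"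
  proof (subst card_Un_disjoint)
    show "(\<lambda>i. 2 * i) ` {..<m div 2} \<inter> (\<lambda>i. 2 * i + 1) ` {..<?h} = {}"
      by (auto dest: arg_cong[of _ _ even])
  qed (auto simp: card_image inj_on_def)
  moreover have "m div 2 + ?h = 3 * m div 4"
    by presburger
  ultimately show ?thesis by simp
qed

lemma parcs_graph_complement_wheel_iff:
  "(Inr u, Inr v) \<in> parcs (graph_complement (wheel_graph n)) \<longleftrightarrow>
     u < n - 1 \<and> v < n - 1 \<and> u \<noteq> v \<and> (u, v) \<notin> parcs (cycle_graph (n - 1))"
  by (auto simp: graph_complement_def wheel_graph_def graph_join_def cycle_graph_def)

lemma cycle_graph_arc_sym: "(u, v) \<in> parcs (cycle_graph m) \<longleftrightarrow> (v, u) \<in> parcs (cycle_graph m)"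
  by (auto simp: cycle_graph_def)

section \<open>Non-adjacency in the cycle\<close>

text \<open>The hub of a moved vertex is odd, hence not 0, and lies at least two below it. This
  excludes both consecutive vertices and the closing edge.\<close>

lemma hub_not_adjacent:
  assumes m: "5 \<le> m" and x: "x < m" "hub m x \<noteq> x"
  shows "(hub m x, x) \<notin> parcs (cycle_graph m)"
proof -
  define h where "h = (m + 1) div 4"
  have h: "1 \<le> h" "4 * h \<le> m + 1" using m by (auto simp: h_def)
  have "0 < hub m x" "hub m x + 2 \<le> x"
    using x h m unfolding hub_eq[OF h_def] by (auto simp: min_def odd_pos split: if_splits)
  then show ?thesis
    using x by (simp add: cycle_graph_arc_iff)
qed

text \<open>If the hub \<open>a\<close> is itself a cycle neighbour of \<open>x\<close>, another
  vertex of its star is far enough from \<open>x\<close>.\<close>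

lemma even_odd_hub_joined:
  assumes m: "5 \<le> m" and x: "even x" "x < m - 1" and a: "odd a" "a < 2 * ((m + 1) div 4)"
  shows "\<exists>v < m. hub m v = a \<and> v \<noteq> x \<and> (x, v) \<notin> parcs (cycle_graph m)"
proof -
  define h where "h = (m + 1) div 4"
  have h: "1 \<le> h" "4 * h \<le> m + 1" "a < 2 * h" using m a by (auto simp: h_def)
  have nonadj: "(x, v) \<notin> parcs (cycle_graph m)"
    if "v < m" "x \<noteq> v" "x + 1 \<noteq> v" "v + 1 \<noteq> x" "x = 0 \<Longrightarrow> v \<noteq> m - 1" for v
    using that x cycle_graph_arc_iff[of x v m] cycle_graph_arc_iff[of v x m]
    by (cases x v rule: linorder_cases) (auto simp: cycle_graph_arc_sym[of x v])
  \<comment> \<open>If \<open>a\<close> is next to \<open>x\<close>, the partner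
    \<open>a + 2 * h\<close> serves unless \<open>a\<close> is the last hub. There
    \<open>m - 1\<close> serves, except for \<open>x = 0\<close>, to which it is adjacent.\<close>
  consider "x + 1 \<noteq> a" "a + 1 \<noteq> x" | "x + 1 = a \<or> a + 1 = x" "a + 2 < 2 * h"
    | "x + 1 = a \<or> a + 1 = x" "a + 1 = 2 * h" "x = 0"
    | "x + 1 = a \<or> a + 1 = x" "a + 1 = 2 * h" "x \<noteq> 0"
  proof -
    have "a + 1 = 2 * h \<or> a + 2 < 2 * h"
      using h(3) a(1) by presburger
    with that show ?thesis by metis
  qed
  then show ?thesis
  proof cases
    case 1
    then show ?thesis
      using a x h hub_odd[OF a] by (intro exI[of _ a] conjI nonadj) auto
  next
    case 2
    then have "hub m (a + 2 * h) = a"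
      using a by (simp add: hub_eq[OF h_def])
    with 2 show ?thesis
      using h by (intro exI[of _ "a + 2 * h"] conjI nonadj) auto
  next
    case 3
    \<comment> \<open>The only odd hub next to 0 is 1. The witness 3 is in its star and, since
      \<open>m\<close> is at least 5, differs from \<open>m - 1\<close>, the other neighbour of
      0.\<close>
    then have "a = 1" "h = 1" using h by auto
    then have "hub m 3 = a"
      using m by (simp add: hub_eq[OF h_def])
    with 3 \<open>a = 1\<close> m show ?thesis
      by (intro exI[of _ 3] conjI nonadj) auto
  next
    case 4
    have "hub m (m - 1) = a"
    proof (cases "even (m - 1)")
      case True
      then show ?thesis
        unfolding hub_eq[OF h_def] using 4(2) by simp
    next
      case False
      then have "even m" using m by simp
      \<comment> \<open>Parity sharpens the bound by one, which is just enough for the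
        \<open>min\<close> to take the value \<open>2 * h - 1\<close> at
        \<open>m - 1\<close>.\<close>
      then have "4 * h \<le> m"
        using h(2) by (cases "4 * h = m + 1") (auto dest: arg_cong[of _ _ even])
      then have "\<not> m - 1 < 2 * h" "min (m - 1 - 2 * h) (2 * h - 1) = a"
        using 4(2) h(1) by linarith+
      with False show ?thesis
        unfolding hub_eq[OF h_def] by presburger
    qed
    \<comment> \<open>Since \<open>x\<close> is at most \<open>a + 1 = 2 * h\<close>, this keeps
      \<open>x + 1\<close> below \<open>m - 1\<close>.\<close>
    moreover have "2 * h + 2 < m"
      using h(2) m by presburger
    ultimately show ?thesis
      using 4 x m
      by (intro exI[of _ "m - 1"] conjI nonadj) auto
  qed
qed

lemma hubs_joined:
  assumes m: "5 \<le> m" and x: "x \<in> hub m ` {..<m}" and y: "y \<in> hub m ` {..<m}" and "x \<noteq> y"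
  shows "\<exists>u < m. \<exists>v < m. hub m u = x \<and> hub m v = y \<and> u \<noteq> v \<and> (u, v) \<notin> parcs (cycle_graph m)"
proof -
  have fixed: "hub m x = x" "hub m y = y" "x < m" "y < m"
    using x y hub_idem[OF m] hub_less[OF m] by auto
  have kinds: "even z \<and> z < m - 1 \<or> odd z \<and> z < 2 * ((m + 1) div 4)"
    if "z \<in> hub m ` {..<m}" for z
    using that hub_cases[OF m] by auto
  consider "even x \<longleftrightarrow> even y" | "even x" "odd y" | "odd x" "even y" by blast
  then show ?thesis
  proof cases
    case 1
    \<comment> \<open>Equal parity excludes consecutive vertices. The closing edge would need
      \<open>u = 0\<close>, making \<open>v\<close> even and hence smaller than
      \<open>m - 1\<close>.\<close>
    have far: "(u, v) \<notin> parcs (cycle_graph m)"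
      if "u < v" "v < m" "even u \<longleftrightarrow> even v" "even v \<Longrightarrow> v < m - 1" for u v
      using that by (auto simp: cycle_graph_arc_iff)
    have "(x, y) \<notin> parcs (cycle_graph m)"
      using far[of x y] far[of y x] kinds[OF x] kinds[OF y] fixed 1 \<open>x \<noteq> y\<close>
      by (cases x y rule: linorder_cases) (auto simp: cycle_graph_arc_sym[of x y])
    then show ?thesis using fixed \<open>x \<noteq> y\<close> by blast
  next
    case 2
    then show ?thesis
      using even_odd_hub_joined[OF m, of x y] kinds[OF x] kinds[OF y] fixed by metis
  next
    case 3
    then show ?thesis
      using even_odd_hub_joined[OF m, of y x] kinds[OF x] kinds[OF y] fixed
        cycle_graph_arc_sym by metis
  qed
qed

section \<open>From the cycle to the wheel\<close>

theorem theorem3: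
  fixes n :: nat
  assumes "n \<ge> 6"
  shows "contains_complete_minor (graph_complement (wheel_graph n)) (3 * (n - 1) div 4)"
proof -
  define m where "m = n - 1"
  have m: "5 \<le> m" using assms by (simp add: m_def)
  let ?W = "graph_complement (wheel_graph n)"
  let ?G = "delete_vertex (Inl ()) ?W"
  define r :: "unit + nat \<Rightarrow> unit + nat" where "r = map_sum id (hub m)"
  have W: "pair_graph ?W"
    using assms by (intro pair_graph_graph_complement pair_graph_wheel_graph) simp
  have centre: "Inl () \<in> pverts ?W"
    by (auto simp: graph_complement_def wheel_graph_def graph_join_def single_vertex_graph_def)
  have G: "pair_graph ?G"
    using pair_graph_minor_step[OF vertex_deletion[OF centre] W] .
  have verts: "pverts ?G = Inr ` {..<m}"
    by (auto simp: delete_vertex_def graph_complement_def wheel_graph_def graph_join_def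
        single_vertex_graph_def cycle_graph_def m_def)
  have arcs: "(Inr u, Inr v) \<in> parcs ?G \<longleftrightarrow>
      u < m \<and> v < m \<and> u \<noteq> v \<and> (u, v) \<notin> parcs (cycle_graph m)" for u v
    using parcs_graph_complement_wheel_iff[of u v n] by (simp add: delete_vertex_def m_def)
  have image: "r ` pverts ?G = Inr ` hub m ` {..<m}"
    by (simp add: verts r_def image_image)
  have "contains_complete_minor ?G (card (r ` pverts ?G))"
  proof (rule contains_complete_minor_stars[OF G])
    fix v assume v: "v \<in> pverts ?G"
    then show "r (r v) = r v"
      using hub_idem[OF m] by (auto simp: verts r_def)
    assume "r v \<noteq> v"
    with v show "(r v, v) \<in> parcs ?G"
      using hub_less[OF m] hub_not_adjacent[OF m] by (auto simp: verts r_def arcs)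
  next
    fix x y assume "x \<in> r ` pverts ?G" "y \<in> r ` pverts ?G" "x \<noteq> y"
    then obtain a b where ab: "x = Inr a" "y = Inr b" "a \<in> hub m ` {..<m}" "b \<in> hub m ` {..<m}"
      "a \<noteq> b" unfolding image by blast
    from hubs_joined[OF m ab(3-5)] obtain u v where "u < m" "v < m" "hub m u = a" "hub m v = b"
      "u \<noteq> v" "(u, v) \<notin> parcs (cycle_graph m)" by blast
    then show "\<exists>(u, v) \<in> parcs ?G. r u = x \<and> r v = y"
      by (intro bexI[of _ "(Inr u, Inr v)"]) (auto simp: arcs r_def ab)
  qed
  moreover have "card (r ` pverts ?G) = 3 * (n - 1) div 4"
    unfolding image using card_hub[OF m] by (simp add: card_image m_def)
  ultimately show ?thesis
    using contains_complete_minor_delete_vertex[OF centre] by simp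
qed

end
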